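(* Let $A=\log J$ be a Hölder normalized potential on $M=\{0,1\}^{\mathbb{N}}$ and let $\mu$ be its equilibrium probability for the shift. Then there exists a Fourier-like basis of the space $L^2(\mu)$.
   Context: A potential $A$ on $M=\{0,1\}^{\mathbb{N}}$ is normalized if $\sum_{\sigma(y)=x}e^{A(y)}=1$ for all $x$, where $\sigma$ is the shift; $J=e^A$ is its Jacobian. The equilibrium probability $\mu$ is the unique shift-invariant probability with $\mathscr{L}_A^*\mu=\mu$, where $\mathscr{L}_Af(x)=\sum_{\sigma(y)=x}e^{A(y)}f(y)$. A Fourier-like basis of $L^2(\mu)$ is a countable orthonormal Hilbert basis $(\rho_n)_{n\in\mathbb{N}}$ of $L^2(\mu)$, consisting of continuous functions, for which there exist constants $a>0$, $b>0$ such that all the $\rho_n$ have $C^0$ norm and $L^2(\mu)$ norm bounded above by $b$ and bounded below by $a$. *)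

theory Defs
  imports "HOL-Probability.Probability"
begin

(* M = {0,1}^N is the type nat => bool.  The library instances give it the product of the
   discrete (order) topologies on bool, and borel is its Borel sigma-algebra. *)
type_synonym bseq = "nat \<Rightarrow> bool"

definition shift :: "bseq \<Rightarrow> bseq" where
  "shift x = (\<lambda>n. x (Suc n))"

(* The usual metric 2^(-N), N the first index where the sequences differ; it induces the
   product topology.  Replacing 2 by another base > 1 changes only Hoelder exponents. *)
definition bseq_dist :: "bseq \<Rightarrow> bseq \<Rightarrow> real" where
  "bseq_dist x y = (if x = y then 0 else (1 / 2) ^ (LEAST n. x n \<noteq> y n))"

definition holder :: "(bseq \<Rightarrow> real) \<Rightarrow> bool" where
  "holder A \<longleftrightarrow> (\<exists>C \<alpha>. 0 < \<alpha> \<and> \<alpha> \<le> 1 \<and>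
     (\<forall>x y. \<bar>A x - A y\<bar> \<le> C * bseq_dist x y powr \<alpha>))"

(* Fibres of the shift have exactly two points, so sums over them are genuine. *)
definition normalized :: "(bseq \<Rightarrow> real) \<Rightarrow> bool" where
  "normalized A \<longleftrightarrow> (\<forall>x. (\<Sum>y\<in>shift -` {x}. exp (A y)) = 1)"

definition transfer_op :: "(bseq \<Rightarrow> real) \<Rightarrow> (bseq \<Rightarrow> real) \<Rightarrow> bseq \<Rightarrow> real" where
  "transfer_op A f x = (\<Sum>y\<in>shift -` {x}. exp (A y) * f y)"

(* The dual operator acts on measures by duality with C(M): the last conjunct says that
   the measure is fixed by it. *)
definition equilibrium_probability :: "(bseq \<Rightarrow> real) \<Rightarrow> bseq measure \<Rightarrow> bool" where
  "equilibrium_probability A \<mu> \<longleftrightarrow>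
     prob_space \<mu> \<and> sets \<mu> = sets borel \<and>
     distr \<mu> borel shift = \<mu> \<and>
     (\<forall>f. continuous_on UNIV f \<longrightarrow> (\<integral>x. transfer_op A f x \<partial>\<mu>) = (\<integral>x. f x \<partial>\<mu>))"

(* Representatives of elements of L^2, not identified almost everywhere. *)
definition L2_space :: "'a measure \<Rightarrow> ('a \<Rightarrow> real) set" where
  "L2_space \<mu> = {f \<in> borel_measurable \<mu>. integrable \<mu> (\<lambda>x. (f x)\<^sup>2)}"

definition L2_inner :: "'a measure \<Rightarrow> ('a \<Rightarrow> real) \<Rightarrow> ('a \<Rightarrow> real) \<Rightarrow> real" where
  "L2_inner \<mu> f g = (\<integral>x. f x * g x \<partial>\<mu>)"

definition L2_norm :: "'a measure \<Rightarrow> ('a \<Rightarrow> real) \<Rightarrow> real" where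
  "L2_norm \<mu> f = sqrt (L2_inner \<mu> f f)"

(* A Hilbert basis: an orthonormal family whose finite linear combinations are dense. *)
definition L2_hilbert_basis :: "'a measure \<Rightarrow> (nat \<Rightarrow> 'a \<Rightarrow> real) \<Rightarrow> bool" where
  "L2_hilbert_basis \<mu> \<rho> \<longleftrightarrow>
     (\<forall>n. \<rho> n \<in> L2_space \<mu>) \<and>
     (\<forall>m n. L2_inner \<mu> (\<rho> m) (\<rho> n) = (if m = n then 1 else 0)) \<and>
     (\<forall>f\<in>L2_space \<mu>. \<forall>\<epsilon>>0. \<exists>N c.
        L2_norm \<mu> (\<lambda>x. f x - (\<Sum>n<N. c n * \<rho> n x)) < \<epsilon>)"

(* Only meaningful for bounded functions, in particular for continuous functions on
   the compact space M. *)
definition C0_norm :: "('a \<Rightarrow> real) \<Rightarrow> real" where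
  "C0_norm f = (SUP x. \<bar>f x\<bar>)"

definition fourier_like_basis :: "bseq measure \<Rightarrow> (nat \<Rightarrow> bseq \<Rightarrow> real) \<Rightarrow> bool" where
  "fourier_like_basis \<mu> \<rho> \<longleftrightarrow>
     L2_hilbert_basis \<mu> \<rho> \<and>
     (\<forall>n. continuous_on UNIV (\<rho> n)) \<and>
     (\<exists>a b. 0 < a \<and> 0 < b \<and>
        (\<forall>n. a \<le> C0_norm (\<rho> n) \<and> C0_norm (\<rho> n) \<le> b \<and>
             a \<le> L2_norm \<mu> (\<rho> n) \<and> L2_norm \<mu> (\<rho> n) \<le> b))"

end

theory Submission
  imports Defs
begin

text \<open>The cosines $1, \sqrt 2 \cos (n \pi t)$ form an orthonormal basis of $L^2[0,1]$ and are bounded by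
$\sqrt 2$. Hence a Fourier-like basis of $L^2(\mu)$ is obtained by composing them with any
continuous function \<open>F\<close> that carries \<open>\<mu>\<close> to Lebesgue measure on $[0,1]$ and separates points up
to null sets: boundedness, continuity and orthonormality pass to the composites at once.

Such an \<open>F\<close> exists because \<open>\<mu>\<close> has no atoms. The map $x \mapsto \sum_n x_n 3^{-n}$
(\<open>ternary_value\<close>) embeds the space of binary sequences into the line, the image of \<open>\<mu>\<close> is an
atomless distribution on the line, so its distribution function is continuous, and a random variable
composed with its own continuous distribution function is uniformly distributed
(\<open>distr_cdf_uniform\<close>). Thus \<open>F\<close> is the distribution function of the image, evaluated at
\<open>ternary_value\<close>.

That there are no atoms (\<open>equilibrium_atomless\<close>) is where the potential enters. A Hoelder function
is bounded and the two values of the Jacobian over a fibre of the shift add up to 1, so the Jacobian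
is at most some $\theta < 1$. Since indicators of cylinders are continuous, the invariance of \<open>\<mu>\<close>
under the dual transfer operator bounds the mass of a cylinder of length \<open>n\<close> by $\theta^n$.

Completeness (\<open>cosine_system_hilbert_basis\<close>) is proved by enlarging the closed span step by step.
It contains the powers of $U = \cos (\pi F)$, hence by Weierstrass the continuous functions of \<open>U\<close>,
hence the indicators of the sets $\{U \ge c\}$. As cosine is decreasing on $[0,\pi]$, these are the
sets $\{F \le s\}$, which up to null sets include all sets \<open>{ternary_value \<le> r}\<close>. A Dynkin argument
gives the indicators of all Borel sets, and simple functions give the whole space. Apart from the
algebra of linear combinations, every step is an instance of closure under dominated
limits (\<open>L2_closed_span_dominated\<close>).\<close>

section \<open>Closed linear spans in the space of square integrable functions\<close>

definition L2_closed_span :: "'a measure \<Rightarrow> (nat \<Rightarrow> 'a \<Rightarrow> real) \<Rightarrow> ('a \<Rightarrow> real) set" where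
  "L2_closed_span M \<rho> = {f \<in> L2_space M.
     \<forall>\<epsilon>>0. \<exists>N c. L2_norm M (\<lambda>x. f x - (\<Sum>n<N. c n * \<rho> n x)) < \<epsilon>}"

lemma L2_norm_less_iff:
  assumes "0 < \<epsilon>"
  shows "L2_norm M f < \<epsilon> \<longleftrightarrow> (\<integral>x. (f x)\<^sup>2 \<partial>M) < \<epsilon>\<^sup>2"
proof -
  have "L2_norm M f < \<epsilon> \<longleftrightarrow> sqrt (\<integral>x. (f x)\<^sup>2 \<partial>M) < sqrt (\<epsilon>\<^sup>2)"
    using assms by (simp add: L2_norm_def L2_inner_def power2_eq_square)
  then show ?thesis by (simp only: real_sqrt_less_iff)
qed

lemma square_add_le: "((a::real) + b)\<^sup>2 \<le> 2 * a\<^sup>2 + 2 * b\<^sup>2"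
  using sum_squares_bound[of a b] by (simp add: power2_sum)

lemma L2_space_scale: "f \<in> L2_space M \<Longrightarrow> (\<lambda>x. c * f x) \<in> L2_space M"
  by (auto simp: L2_space_def power_mult_distrib)

lemma L2_space_add:
  assumes "f \<in> L2_space M" "g \<in> L2_space M"
  shows "(\<lambda>x. f x + g x) \<in> L2_space M"
proof -
  have [measurable]: "f \<in> borel_measurable M" "g \<in> borel_measurable M"
    using assms by (auto simp: L2_space_def)
  have "integrable M (\<lambda>x. 2 * (f x)\<^sup>2 + 2 * (g x)\<^sup>2)"
    using assms by (auto simp: L2_space_def)
  then have "integrable M (\<lambda>x. (f x + g x)\<^sup>2)"
    by (rule Bochner_Integration.integrable_bound) (auto intro!: AE_I2 square_add_le)
  then show ?thesis by (auto simp: L2_space_def)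
qed

lemma L2_space_diff:
  assumes "f \<in> L2_space M" "g \<in> L2_space M"
  shows "(\<lambda>x. f x - g x) \<in> L2_space M"
  using L2_space_add[OF assms(1) L2_space_scale[OF assms(2), of "-1"]] by simp

lemma L2_space_sum:
  assumes "\<And>n. \<rho> n \<in> L2_space M"
  shows "(\<lambda>x. \<Sum>n<(N::nat). c n * \<rho> n x) \<in> L2_space M"
proof (induction N)
  case 0 show ?case by (auto simp: L2_space_def)
next
  case (Suc N)
  then show ?case using L2_space_add[OF Suc L2_space_scale[OF assms]] by simp
qed

lemma integral_square_add_le:
  assumes "f \<in> L2_space M" "g \<in> L2_space M"
  shows "(\<integral>x. (f x + g x)\<^sup>2 \<partial>M) \<le> 2 * (\<integral>x. (f x)\<^sup>2 \<partial>M) + 2 * (\<integral>x. (g x)\<^sup>2 \<partial>M)"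
proof -
  have i: "integrable M (\<lambda>x. (f x)\<^sup>2)" "integrable M (\<lambda>x. (g x)\<^sup>2)"
    using assms by (auto simp: L2_space_def)
  have "(\<integral>x. (f x + g x)\<^sup>2 \<partial>M) \<le> (\<integral>x. 2 * (f x)\<^sup>2 + 2 * (g x)\<^sup>2 \<partial>M)"
    using i L2_space_add[OF assms]
    by (intro integral_mono) (auto simp: L2_space_def square_add_le)
  also have "\<dots> = 2 * (\<integral>x. (f x)\<^sup>2 \<partial>M) + 2 * (\<integral>x. (g x)\<^sup>2 \<partial>M)"
    using i by simp
  finally show ?thesis .
qed

text \<open>Squared norms avoid both square roots and Minkowski's inequality: the crude bound
$(a+b)^2 \le 2a^2 + 2b^2$ is enough for all approximation arguments below.\<close>

lemma L2_closed_span_iff: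
  "f \<in> L2_closed_span M \<rho> \<longleftrightarrow> f \<in> L2_space M \<and>
     (\<forall>\<epsilon>>0. \<exists>N c. (\<integral>x. (f x - (\<Sum>n<N. c n * \<rho> n x))\<^sup>2 \<partial>M) < \<epsilon>)"
proof -
  have "(\<forall>\<epsilon>>0. \<exists>N c. L2_norm M (\<lambda>x. f x - (\<Sum>n<N. c n * \<rho> n x)) < \<epsilon>) \<longleftrightarrow>
        (\<forall>\<epsilon>>0. \<exists>N c. (\<integral>x. (f x - (\<Sum>n<N. c n * \<rho> n x))\<^sup>2 \<partial>M) < \<epsilon>)" (is "?l \<longleftrightarrow> ?r")
  proof
    assume l: ?l
    show ?r
    proof (intro allI impI)
      fix \<epsilon> :: real assume "\<epsilon> > 0"
      with l[rule_format, of "sqrt \<epsilon>"] show "\<exists>N c. (\<integral>x. (f x - (\<Sum>n<N. c n * \<rho> n x))\<^sup>2 \<partial>M) < \<epsilon>"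
        by (simp add: L2_norm_less_iff)
    qed
  next
    assume r: ?r
    show ?l
    proof (intro allI impI)
      fix \<epsilon> :: real assume "\<epsilon> > 0"
      with r[rule_format, of "\<epsilon>\<^sup>2"] show "\<exists>N c. L2_norm M (\<lambda>x. f x - (\<Sum>n<N. c n * \<rho> n x)) < \<epsilon>"
        by (simp add: L2_norm_less_iff)
    qed
  qed
  then show ?thesis by (simp add: L2_closed_span_def)
qed

lemma L2_closed_span_closed:
  assumes \<rho>: "\<And>n. \<rho> n \<in> L2_space M" and f: "f \<in> L2_space M"
    and approx: "\<And>\<epsilon>. 0 < \<epsilon> \<Longrightarrow> \<exists>g\<in>L2_closed_span M \<rho>. (\<integral>x. (f x - g x)\<^sup>2 \<partial>M) < \<epsilon>"
  shows "f \<in> L2_closed_span M \<rho>"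
  unfolding L2_closed_span_iff
proof (intro conjI allI impI f)
  fix \<epsilon> :: real assume "\<epsilon> > 0"
  then obtain g where g: "g \<in> L2_closed_span M \<rho>" "(\<integral>x. (f x - g x)\<^sup>2 \<partial>M) < \<epsilon> / 4"
    using approx[of "\<epsilon> / 4"] by auto
  then obtain N c where Nc: "(\<integral>x. (g x - (\<Sum>n<N. c n * \<rho> n x))\<^sup>2 \<partial>M) < \<epsilon> / 4"
    using \<open>\<epsilon> > 0\<close> unfolding L2_closed_span_iff by (metis divide_pos_pos zero_less_numeral)
  have gL: "g \<in> L2_space M" using g by (simp add: L2_closed_span_def)
  have "(\<integral>x. (f x - (\<Sum>n<N. c n * \<rho> n x))\<^sup>2 \<partial>M)
      = (\<integral>x. ((f x - g x) + (g x - (\<Sum>n<N. c n * \<rho> n x)))\<^sup>2 \<partial>M)" by simp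
  also have "\<dots> \<le> 2 * (\<integral>x. (f x - g x)\<^sup>2 \<partial>M)
      + 2 * (\<integral>x. (g x - (\<Sum>n<N. c n * \<rho> n x))\<^sup>2 \<partial>M)"
    by (intro integral_square_add_le L2_space_diff f gL L2_space_sum \<rho>)
  also have "\<dots> < \<epsilon>" using g(2) Nc by simp
  finally show "\<exists>N c. (\<integral>x. (f x - (\<Sum>n<N. c n * \<rho> n x))\<^sup>2 \<partial>M) < \<epsilon>" by blast
qed

lemma L2_closed_span_scale:
  assumes "f \<in> L2_closed_span M \<rho>"
  shows "(\<lambda>x. a * f x) \<in> L2_closed_span M \<rho>"
  unfolding L2_closed_span_iff
proof (intro conjI allI impI)
  show "(\<lambda>x. a * f x) \<in> L2_space M"
    using assms by (auto simp: L2_closed_span_def intro: L2_space_scale)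
  fix \<epsilon> :: real assume "\<epsilon> > 0"
  then have "0 < \<epsilon> / (a\<^sup>2 + 1)" by (simp add: add_nonneg_pos)
  then obtain N c where Nc: "(\<integral>x. (f x - (\<Sum>n<N. c n * \<rho> n x))\<^sup>2 \<partial>M) < \<epsilon> / (a\<^sup>2 + 1)"
    using assms unfolding L2_closed_span_iff by metis
  let ?I = "\<integral>x. (f x - (\<Sum>n<N. c n * \<rho> n x))\<^sup>2 \<partial>M"
  have "0 \<le> ?I" by simp
  have "(\<integral>x. (a * f x - (\<Sum>n<N. (a * c n) * \<rho> n x))\<^sup>2 \<partial>M)
      = (\<integral>x. a\<^sup>2 * (f x - (\<Sum>n<N. c n * \<rho> n x))\<^sup>2 \<partial>M)"
    by (simp add: power_mult_distrib[symmetric] sum_distrib_left right_diff_distrib mult.assoc)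
  also have "\<dots> = a\<^sup>2 * ?I" by simp
  also have "\<dots> \<le> (a\<^sup>2 + 1) * ?I" using \<open>0 \<le> ?I\<close> by (simp add: distrib_right)
  also have "\<dots> < \<epsilon>"
    using Nc by (simp add: pos_less_divide_eq add_nonneg_pos mult.commute)
  finally show "\<exists>N c. (\<integral>x. (a * f x - (\<Sum>n<N. c n * \<rho> n x))\<^sup>2 \<partial>M) < \<epsilon>"
    by (intro exI[of _ N] exI[of _ "\<lambda>n. a * c n"])
qed

text \<open>Lets two linear combinations of different lengths be added.\<close>

lemma sum_pad_zero:
  fixes c :: "nat \<Rightarrow> real"
  assumes "N \<le> K"
  shows "(\<Sum>n<K. (if n < N then c n else 0) * r n) = (\<Sum>n<N. c n * r n)"
proof -
  have "(\<Sum>n<N. (if n < N then c n else 0) * r n) = (\<Sum>n<K. (if n < N then c n else 0) * r n)"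
    using assms by (intro sum.mono_neutral_left) auto
  then show ?thesis by simp
qed

lemma L2_closed_span_add:
  assumes \<rho>: "\<And>n. \<rho> n \<in> L2_space M"
    and f: "f \<in> L2_closed_span M \<rho>" and g: "g \<in> L2_closed_span M \<rho>"
  shows "(\<lambda>x. f x + g x) \<in> L2_closed_span M \<rho>"
  unfolding L2_closed_span_iff
proof (intro conjI allI impI)
  have fL: "f \<in> L2_space M" and gL: "g \<in> L2_space M" using f g by (auto simp: L2_closed_span_def)
  then show "(\<lambda>x. f x + g x) \<in> L2_space M" by (rule L2_space_add)
  fix \<epsilon> :: real assume "\<epsilon> > 0"
  then have "\<epsilon> / 4 > 0" by simp
  obtain N c where Nc: "(\<integral>x. (f x - (\<Sum>n<N. c n * \<rho> n x))\<^sup>2 \<partial>M) < \<epsilon> / 4"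
    using f \<open>\<epsilon> / 4 > 0\<close> unfolding L2_closed_span_iff by metis
  obtain K d where Kd: "(\<integral>x. (g x - (\<Sum>n<K. d n * \<rho> n x))\<^sup>2 \<partial>M) < \<epsilon> / 4"
    using g \<open>\<epsilon> / 4 > 0\<close> unfolding L2_closed_span_iff by metis
  define e where "e n = (if n < N then c n else 0) + (if n < K then d n else 0)" for n
  have e: "(\<Sum>n<max N K. e n * \<rho> n x) = (\<Sum>n<N. c n * \<rho> n x) + (\<Sum>n<K. d n * \<rho> n x)" for x
    by (simp add: e_def distrib_right sum.distrib sum_pad_zero)
  have "(\<integral>x. (f x + g x - (\<Sum>n<max N K. e n * \<rho> n x))\<^sup>2 \<partial>M)
      = (\<integral>x. ((f x - (\<Sum>n<N. c n * \<rho> n x)) + (g x - (\<Sum>n<K. d n * \<rho> n x)))\<^sup>2 \<partial>M)"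
    by (simp add: e algebra_simps)
  also have "\<dots> \<le> 2 * (\<integral>x. (f x - (\<Sum>n<N. c n * \<rho> n x))\<^sup>2 \<partial>M)
      + 2 * (\<integral>x. (g x - (\<Sum>n<K. d n * \<rho> n x))\<^sup>2 \<partial>M)"
    by (intro integral_square_add_le L2_space_diff fL gL L2_space_sum \<rho>)
  also have "\<dots> < \<epsilon>" using Nc Kd by simp
  finally show "\<exists>N c. (\<integral>x. (f x + g x - (\<Sum>n<N. c n * \<rho> n x))\<^sup>2 \<partial>M) < \<epsilon>" by blast
qed

lemma L2_closed_span_zero: "(\<lambda>x. 0) \<in> L2_closed_span M \<rho>"
  unfolding L2_closed_span_iff by (auto simp: L2_space_def intro!: exI[of _ "0::nat"])

lemma L2_closed_span_sum:
  assumes \<rho>: "\<And>n. \<rho> n \<in> L2_space M" and "finite I"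
    and "\<And>i. i \<in> I \<Longrightarrow> f i \<in> L2_closed_span M \<rho>"
  shows "(\<lambda>x. \<Sum>i\<in>I. f i x) \<in> L2_closed_span M \<rho>"
  using assms(2,3)
  by (induction I rule: finite_induct) (auto intro!: L2_closed_span_zero L2_closed_span_add \<rho>)

lemma L2_closed_span_base:
  assumes "\<And>n. \<rho> n \<in> L2_space M"
  shows "\<rho> n \<in> L2_closed_span M \<rho>"
  unfolding L2_closed_span_iff
proof (intro conjI allI impI assms)
  have "(\<Sum>i<Suc n. of_bool (i = n) * \<rho> i x) = \<rho> n x" for x
    by (simp add: of_bool_def if_distrib[of "\<lambda>t. t * _"] cong: if_cong)
  then have "(\<integral>x. (\<rho> n x - (\<Sum>i<Suc n. of_bool (i = n) * \<rho> i x))\<^sup>2 \<partial>M) = 0" by simp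
  then show "\<exists>N c. (\<integral>x. (\<rho> n x - (\<Sum>n<N. c n * \<rho> n x))\<^sup>2 \<partial>M) < \<epsilon>" if "\<epsilon> > 0" for \<epsilon>
    using that by (intro exI[of _ "Suc n"] exI[of _ "\<lambda>i. of_bool (i = n)"]) (simp only:)
qed

text \<open>By dominated convergence the distances to the limit tend to 0, since the squared differences are at
most $4 w^2$. The almost everywhere form of the limit also makes membership in the closed span
insensitive to null sets.\<close>

lemma L2_closed_span_dominated:
  assumes \<rho>: "\<And>n. \<rho> n \<in> L2_space M"
    and s: "\<And>i::nat. s i \<in> L2_closed_span M \<rho>"
    and f[measurable]: "f \<in> borel_measurable M" and w: "w \<in> L2_space M"
    and lim: "AE x in M. (\<lambda>i. s i x) \<longlonglongrightarrow> f x"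
    and bound: "\<And>i x. x \<in> space M \<Longrightarrow> \<bar>s i x\<bar> \<le> w x"
  shows "f \<in> L2_closed_span M \<rho>"
proof -
  have [measurable]: "\<And>i. s i \<in> borel_measurable M" "w \<in> borel_measurable M"
    using s w by (auto simp: L2_closed_span_def L2_space_def)
  have fw: "AE x in M. \<bar>f x\<bar> \<le> w x"
    using lim AE_space
  proof eventually_elim
    case (elim x)
    then have "(\<lambda>i. \<bar>s i x\<bar>) \<longlonglongrightarrow> \<bar>f x\<bar>" by (intro tendsto_rabs)
    then show ?case by (rule LIMSEQ_le_const2) (use elim bound in auto)
  qed
  have wi: "integrable M (\<lambda>x. (w x)\<^sup>2)" using w by (simp add: L2_space_def)
  have fL: "f \<in> L2_space M"
  proof -
    have "integrable M (\<lambda>x. (f x)\<^sup>2)"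
      by (rule Bochner_Integration.integrable_bound[OF wi])
         (use fw in \<open>auto elim!: eventually_mono simp: abs_le_square_iff[symmetric]\<close>)
    then show ?thesis by (simp add: L2_space_def)
  qed
  have "(\<lambda>i. \<integral>x. (f x - s i x)\<^sup>2 \<partial>M) \<longlonglongrightarrow> (\<integral>x. 0 \<partial>M)"
  proof (rule integral_dominated_convergence[where w = "\<lambda>x. 4 * (w x)\<^sup>2"])
    show "integrable M (\<lambda>x. 4 * (w x)\<^sup>2)" using wi by simp
    show "AE x in M. (\<lambda>i. (f x - s i x)\<^sup>2) \<longlonglongrightarrow> 0"
      using lim
    proof eventually_elim
      case (elim x)
      then have "(\<lambda>i. (f x - s i x)\<^sup>2) \<longlonglongrightarrow> (f x - f x)\<^sup>2" by (intro tendsto_intros)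
      then show ?case by simp
    qed
    show "AE x in M. norm ((f x - s i x)\<^sup>2) \<le> 4 * (w x)\<^sup>2" for i
      using fw AE_space
    proof eventually_elim
      case (elim x)
      then have "\<bar>f x - s i x\<bar> \<le> \<bar>2 * w x\<bar>" using bound[of x i] by linarith
      then have "(f x - s i x)\<^sup>2 \<le> (2 * w x)\<^sup>2" by (simp only: abs_le_square_iff)
      then show ?case by (simp add: power_mult_distrib)
    qed
  qed auto
  then have lim0: "(\<lambda>i. \<integral>x. (f x - s i x)\<^sup>2 \<partial>M) \<longlonglongrightarrow> 0" by simp
  show ?thesis
  proof (rule L2_closed_span_closed[OF \<rho> fL])
    fix \<epsilon> :: real assume "0 < \<epsilon>"
    with lim0 have "\<forall>\<^sub>F i in sequentially. (\<integral>x. (f x - s i x)\<^sup>2 \<partial>M) < \<epsilon>"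
      by (rule order_tendstoD(2))
    then obtain i where "(\<integral>x. (f x - s i x)\<^sup>2 \<partial>M) < \<epsilon>"
      by (meson eventually_happens trivial_limit_sequentially)
    with s show "\<exists>g\<in>L2_closed_span M \<rho>. (\<integral>x. (f x - g x)\<^sup>2 \<partial>M) < \<epsilon>" by blast
  qed
qed

lemma L2_closed_span_AE_eq:
  assumes \<rho>: "\<And>n. \<rho> n \<in> L2_space M" and g: "g \<in> L2_closed_span M \<rho>"
    and f: "f \<in> borel_measurable M" and eq: "AE x in M. g x = f x"
  shows "f \<in> L2_closed_span M \<rho>"
proof (rule L2_closed_span_dominated[OF \<rho>, where s = "\<lambda>_. g" and w = "\<lambda>x. \<bar>g x\<bar>"])
  show "(\<lambda>x. \<bar>g x\<bar>) \<in> L2_space M" using g by (auto simp: L2_closed_span_def L2_space_def)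
  show "AE x in M. (\<lambda>i. g x) \<longlonglongrightarrow> f x" using eq by eventually_elim simp
qed (use g f in auto)

lemma (in finite_measure) bounded_in_L2_space:
  assumes "f \<in> borel_measurable M" "\<And>x. x \<in> space M \<Longrightarrow> \<bar>f x\<bar> \<le> B"
  shows "f \<in> L2_space M"
proof -
  have "(f x)\<^sup>2 \<le> B\<^sup>2" if "x \<in> space M" for x
  proof -
    have "\<bar>f x\<bar>\<^sup>2 \<le> B\<^sup>2" using assms(2)[OF that] by (intro power_mono) auto
    then show ?thesis by simp
  qed
  then have "integrable M (\<lambda>x. (f x)\<^sup>2)"
    using assms by (intro integrable_const_bound[where B = "B\<^sup>2"]) (auto intro!: AE_I2)
  then show ?thesis using assms by (simp add: L2_space_def)
qed

section \<open>From powers of one function to all square integrable functions\<close>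

text \<open>Weierstrass approximation on $[-1,1]$, the range of \<open>U\<close>.\<close>

lemma (in finite_measure) continuous_comp_in_L2_closed_span:
  fixes h :: "real \<Rightarrow> real"
  assumes \<rho>: "\<And>n. \<rho> n \<in> L2_space M"
    and U[measurable]: "U \<in> borel_measurable M" and U1: "\<And>x. \<bar>U x\<bar> \<le> 1"
    and pow: "\<And>k. (\<lambda>x. U x ^ k) \<in> L2_closed_span M \<rho>"
    and h: "continuous_on UNIV h"
  shows "(\<lambda>x. h (U x)) \<in> L2_closed_span M \<rho>"
proof -
  have h1: "continuous_on {-1..1} h" using h continuous_on_subset by blast
  have "\<exists>g. real_polynomial_function g \<and> (\<forall>t\<in>{-1..1}. \<bar>h t - g t\<bar> < inverse (real (Suc i)))" for i
    by (rule Stone_Weierstrass_real_polynomial_function[OF compact_Icc h1, of "inverse (real (Suc i))"])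
       auto
  then obtain p where p: "\<And>i. real_polynomial_function (p i)"
    and hp: "\<And>i t. t \<in> {-1..1} \<Longrightarrow> \<bar>h t - p i t\<bar> < inverse (real (Suc i))"
    by metis
  have [measurable]: "h \<in> borel_measurable borel" using h by (rule borel_measurable_continuous_onI)
  have "compact (h ` {-1..1})" by (rule compact_continuous_image[OF h1 compact_Icc])
  then obtain B where B: "\<And>t. t \<in> {-1..1} \<Longrightarrow> \<bar>h t\<bar> \<le> B"
    by (metis bounded_real compact_imp_bounded imageI)
  have Umem: "U x \<in> {-1..1}" for x using U1[of x] by auto
  show ?thesis
  proof (rule L2_closed_span_dominated[OF \<rho>, where s = "\<lambda>i x. p i (U x)" and w = "\<lambda>_. B + 1"])
    show "(\<lambda>x. p i (U x)) \<in> L2_closed_span M \<rho>" for i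
    proof -
      obtain a n where "p i = (\<lambda>t. \<Sum>j\<le>n. a j * t ^ j)"
        using p[of i] by (auto simp: real_polynomial_function_iff_sum)
      moreover have "(\<lambda>x. \<Sum>j\<le>n. a j * U x ^ j) \<in> L2_closed_span M \<rho>"
        by (intro L2_closed_span_sum[OF \<rho>] L2_closed_span_scale pow) auto
      ultimately show ?thesis by simp
    qed
    show "(\<lambda>x. B + 1) \<in> L2_space M" by (rule bounded_in_L2_space) auto
    show "AE x in M. (\<lambda>i. p i (U x)) \<longlonglongrightarrow> h (U x)"
    proof (intro AE_I2)
      fix x
      have "(\<lambda>i. h (U x) - p i (U x)) \<longlonglongrightarrow> 0"
        by (rule Lim_null_comparison[OF _ LIMSEQ_inverse_real_of_nat])
           (use hp[OF Umem] in \<open>auto intro!: always_eventually less_imp_le\<close>)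
      then have "(\<lambda>i. h (U x) - (h (U x) - p i (U x))) \<longlonglongrightarrow> h (U x) - 0"
        by (intro tendsto_intros)
      then show "(\<lambda>i. p i (U x)) \<longlonglongrightarrow> h (U x)" by simp
    qed
    show "\<bar>p i (U x)\<bar> \<le> B + 1" for i x
    proof -
      have "inverse (real (Suc i)) \<le> 1" by (simp add: inverse_le_1_iff)
      then show ?thesis using hp[OF Umem[of x], of i] B[OF Umem[of x]] by linarith
    qed
  qed auto
qed

lemma ramp_tendsto_indicator:
  fixes u c :: real
  shows "(\<lambda>k. max 0 (min 1 (1 + real k * (u - c)))) \<longlonglongrightarrow> indicator {c..} u"
proof (cases "c \<le> u")
  case True
  then have "max 0 (min 1 (1 + real k * (u - c))) = 1" for k by simp
  then show ?thesis using True by simp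
next
  case False
  obtain K :: nat where K: "1 / (c - u) < real K" using reals_Archimedean2 by blast
  have "max 0 (min 1 (1 + real k * (u - c))) = 0" if "k \<ge> K" for k
  proof -
    have "1 / (c - u) < real k" using K that by linarith
    then have "1 < real k * (c - u)" using False by (simp add: pos_divide_less_eq)
    then have "1 + real k * (u - c) \<le> 0" by (simp add: algebra_simps)
    then show ?thesis by simp
  qed
  then have "\<forall>\<^sub>F k in sequentially. max 0 (min 1 (1 + real k * (u - c))) = 0"
    by (auto simp: eventually_sequentially)
  then show ?thesis using False by (simp add: tendsto_eventually)
qed

lemma (in finite_measure) superlevel_in_L2_closed_span:
  fixes c :: real
  assumes \<rho>: "\<And>n. \<rho> n \<in> L2_space M"
    and U[measurable]: "U \<in> borel_measurable M" and U1: "\<And>x. \<bar>U x\<bar> \<le> 1"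
    and pow: "\<And>k. (\<lambda>x. U x ^ k) \<in> L2_closed_span M \<rho>"
  shows "(\<lambda>x. indicator {c..} (U x)) \<in> L2_closed_span M \<rho>"
proof (rule L2_closed_span_dominated[OF \<rho>,
      where s = "\<lambda>k x. max 0 (min 1 (1 + real k * (U x - c)))" and w = "\<lambda>_. 1"])
  show "(\<lambda>x. max 0 (min 1 (1 + real k * (U x - c)))) \<in> L2_closed_span M \<rho>" for k
    by (rule continuous_comp_in_L2_closed_span[OF \<rho> U U1 pow]) (intro continuous_intros)
  show "(\<lambda>x. 1) \<in> L2_space M" by (rule bounded_in_L2_space) auto
  show "AE x in M. (\<lambda>k. max 0 (min 1 (1 + real k * (U x - c)))) \<longlonglongrightarrow> indicator {c..} (U x)"
    by (intro AE_I2 ramp_tendsto_indicator)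
qed auto

text \<open>The Borel sets with this property form a Dynkin system, because the closed span is a vector space
closed under bounded limits; the half-lines generate the Borel sets and are closed under
intersection.\<close>

lemma (in finite_measure) borel_vimage_in_L2_closed_span:
  fixes \<phi> :: "'a \<Rightarrow> real"
  assumes \<rho>: "\<And>n. \<rho> n \<in> L2_space M" and \<phi>[measurable]: "\<phi> \<in> borel_measurable M"
    and one: "(\<lambda>x. 1) \<in> L2_closed_span M \<rho>"
    and le: "\<And>r. (\<lambda>x. indicator {..r} (\<phi> x)) \<in> L2_closed_span M \<rho>"
    and B: "B \<in> sets borel"
  shows "(\<lambda>x. indicator B (\<phi> x)) \<in> L2_closed_span M \<rho>"
proof -
  have gen: "sets (borel :: real measure) = sigma_sets UNIV (range (\<lambda>a. {..a}))"
    by (subst borel_eq_atMost) simp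
  have "Int_stable (range (\<lambda>a::real. {..a}))"
    by (auto simp: Int_stable_def)
  moreover have "range (\<lambda>a::real. {..a}) \<subseteq> Pow UNIV" by simp
  moreover have "B \<in> sigma_sets UNIV (range (\<lambda>a. {..a}))" using B gen by simp
  ultimately show ?thesis
  proof (induction rule: sigma_sets_induct_disjoint)
    case (basic A)
    then show ?case using le by auto
  next
    case empty
    show ?case using L2_closed_span_zero by simp
  next
    case (compl A)
    have "(\<lambda>x. 1 + (-1) * indicator A (\<phi> x)) \<in> L2_closed_span M \<rho>"
      by (intro L2_closed_span_add[OF \<rho>] L2_closed_span_scale one compl)
    moreover have "1 + (-1) * indicator A (\<phi> x) = (indicator (UNIV - A) (\<phi> x) :: real)" for x
      by (simp split: split_indicator)
    ultimately show ?case by simp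
  next
    case (union A)
    have [measurable]: "\<And>i. A i \<in> sets borel" using union(2) gen by auto
    have S: "(\<Sum>i<k. indicator (A i) t) = (indicator (\<Union>i<k. A i) t :: real)" for k t
      using union(1) by (subst indicator_UN_disjoint) (auto simp: disjoint_family_on_def)
    show ?case
    proof (rule L2_closed_span_dominated[OF \<rho>,
          where s = "\<lambda>k x. \<Sum>i<k. indicator (A i) (\<phi> x)" and w = "\<lambda>_. 1"])
      show "(\<lambda>x. \<Sum>i<k. indicator (A i) (\<phi> x)) \<in> L2_closed_span M \<rho>" for k
        by (intro L2_closed_span_sum[OF \<rho>] union) auto
      show "(\<lambda>x. 1) \<in> L2_space M" by (rule bounded_in_L2_space) auto
      show "AE x in M. (\<lambda>k. \<Sum>i<k. indicator (A i) (\<phi> x)) \<longlonglongrightarrow> (indicator (\<Union>i. A i) (\<phi> x) :: real)"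
        unfolding S by (intro AE_I2 LIMSEQ_indicator_UN)
      show "(\<lambda>x. indicator (\<Union>i. A i) (\<phi> x) :: real) \<in> borel_measurable M"
        by (rule measurable_compose[OF \<phi> borel_measurable_indicator]) auto
      show "\<bar>\<Sum>i<k. indicator (A i) (\<phi> x)\<bar> \<le> (1::real)" for k x
        by (subst S) (simp split: split_indicator)
    qed
  qed
qed

lemma (in finite_measure) L2_closed_span_eq_L2_space:
  assumes \<rho>: "\<And>n. \<rho> n \<in> L2_space M"
    and ind: "\<And>B. B \<in> sets M \<Longrightarrow> (\<lambda>x. indicator B x) \<in> L2_closed_span M \<rho>"
    and f: "f \<in> L2_space M"
  shows "f \<in> L2_closed_span M \<rho>"
proof -
  have fm[measurable]: "f \<in> borel_measurable M" using f by (simp add: L2_space_def)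
  obtain s where s: "\<And>i. simple_function M (s i)"
    and lim: "\<And>x. x \<in> space M \<Longrightarrow> (\<lambda>i. s i x) \<longlonglongrightarrow> f x"
    and bd: "\<And>i x. x \<in> space M \<Longrightarrow> dist (s i x) 0 \<le> 2 * dist (f x) 0"
    using borel_measurable_implies_sequence_metric[OF fm, of 0] by metis
  show ?thesis
  proof (rule L2_closed_span_dominated[OF \<rho>, where s = s and w = "\<lambda>x. 2 * \<bar>f x\<bar>"])
    show "s i \<in> L2_closed_span M \<rho>" for i
    proof -
      have fin: "finite (s i ` space M)" using s[of i] by (simp add: simple_function_def)
      have "(\<lambda>x. \<Sum>y\<in>s i ` space M. y * indicator (s i -` {y} \<inter> space M) x) \<in> L2_closed_span M \<rho>"
        using s[of i] by (intro L2_closed_span_sum[OF \<rho> fin] L2_closed_span_scale ind)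
          (auto simp: simple_function_def)
      moreover have "(\<Sum>y\<in>s i ` space M. y * indicator (s i -` {y} \<inter> space M) x) = s i x"
        if "x \<in> space M" for x
      proof -
        have "(\<Sum>y\<in>s i ` space M. y * indicator (s i -` {y} \<inter> space M) x)
            = (\<Sum>y\<in>s i ` space M. if y = s i x then y else 0)"
          using that by (intro sum.cong) (auto simp: indicator_def)
        also have "\<dots> = s i x" using fin that by simp
        finally show ?thesis .
      qed
      ultimately show ?thesis
        by (rule L2_closed_span_AE_eq[OF \<rho> _ borel_measurable_simple_function[OF s] AE_I2])
    qed
    show "(\<lambda>x. 2 * \<bar>f x\<bar>) \<in> L2_space M" using f by (auto simp: L2_space_def power_mult_distrib)
    show "AE x in M. (\<lambda>i. s i x) \<longlonglongrightarrow> f x" using lim by auto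
    show "\<bar>s i x\<bar> \<le> 2 * \<bar>f x\<bar>" if "x \<in> space M" for i x using bd[OF that, of i] by simp
  qed measurable
qed


section \<open>Uniform distribution and cosines\<close>

text \<open>Without atoms the distribution function \<open>G\<close> is continuous. For $0 \le t < 1$ the set
$\{G \le t\}$ is therefore a closed half-line ending at a point where \<open>G\<close> takes the value \<open>t\<close>, so it
has measure \<open>t\<close>. If it is empty (only possible for $t = 0$), both sides vanish.\<close>

lemma (in real_distribution) distr_cdf_uniform:
  assumes atomless: "\<And>x. measure M {x} = 0"
  shows "distr M borel (cdf M) = uniform_measure lborel {0..1}"
proof (rule cdf_unique)
  let ?G = "cdf M"
  have contG: "continuous_on UNIV ?G"
    using atomless by (intro continuous_at_imp_continuous_on) (auto simp: isCont_cdf)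
  then have Gm[measurable]: "?G \<in> borel_measurable borel" by (rule borel_measurable_continuous_onI)
  then have [measurable]: "?G \<in> borel_measurable M" by (rule measurable_finite_borel)
  then show "real_distribution (distr M borel ?G)" by (rule real_distribution_distr)
  show "real_distribution (uniform_measure lborel {0..1::real})"
    by (intro real_distribution.intro prob_space_uniform_measure real_distribution_axioms.intro) auto
  show "cdf (distr M borel ?G) = cdf (uniform_measure lborel {0..1})"
  proof
    fix t :: real
    have L: "cdf (distr M borel ?G) t = measure M {x. ?G x \<le> t}"
      unfolding cdf_def2[of "distr M borel ?G"]
      by (subst measure_distr) (auto intro!: arg_cong[of _ _ "measure M"])
    have R: "cdf (uniform_measure lborel {0..1}) t = measure lborel ({0..1} \<inter> {..t})"
      unfolding cdf_def by (subst measure_uniform_measure) auto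
    consider "t < 0" | "1 \<le> t" | "0 \<le> t" "t < 1" by linarith
    then show "cdf (distr M borel ?G) t = cdf (uniform_measure lborel {0..1}) t"
    proof cases
      case 1
      then have "{x. ?G x \<le> t} = {}" by (auto simp: not_le intro: less_le_trans[OF _ cdf_nonneg])
      moreover have "{0..1} \<inter> {..t} = {}" using 1 by auto
      ultimately show ?thesis by (simp add: L R)
    next
      case 2
      then have "{x. ?G x \<le> t} = space M" using cdf_bounded_prob order_trans by auto
      moreover have "{0..1} \<inter> {..t} = {0..1}" using 2 by auto
      ultimately show ?thesis using prob_space by (simp add: L R)
    next
      case 3
      let ?S = "{x. ?G x \<le> t}"
      have "{0..1} \<inter> {..t} = {0..t}" using 3 by auto
      then have R': "cdf (uniform_measure lborel {0..1}) t = t" using 3 by (simp add: R)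
      have "\<forall>\<^sub>F x in at_top. t < ?G x"
        using cdf_lim_at_top_prob 3(2) by (rule order_tendstoD(1))
      then obtain b where b: "t < ?G b" by (auto simp: eventually_at_top_linorder)
      have Sb: "x \<le> b" if "x \<in> ?S" for x
        using cdf_nondecreasing[of b x] that b by (rule_tac ccontr) auto
      show ?thesis
      proof (cases "?S = {}")
        case True
        have "t = 0"
        proof (rule ccontr)
          assume "t \<noteq> 0"
          then have "\<forall>\<^sub>F x in at_bot. ?G x < t"
            using cdf_lim_at_bot 3(1) by (intro order_tendstoD(2)) auto
          then obtain x where "?G x < t" by (auto simp: eventually_at_bot_linorder)
          with True show False using less_imp_le by blast
        qed
        show ?thesis unfolding L R' True using \<open>t = 0\<close> by simp
      next
        case False
        define r where "r = Sup ?S"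
        have bdd: "bdd_above ?S" using Sb by (rule bdd_aboveI)
        have "closed ?S" using contG by (intro closed_Collect_le) (auto intro: continuous_intros)
        then have rS: "r \<in> ?S" unfolding r_def using False bdd by (intro closed_contains_Sup)
        have S_eq: "?S = {..r}"
        proof
          show "?S \<subseteq> {..r}" unfolding r_def using bdd by (auto intro: cSup_upper)
          show "{..r} \<subseteq> ?S" using rS by (auto intro: order_trans[OF cdf_nondecreasing])
        qed
        \<comment> \<open>By the intermediate value theorem \<open>G\<close> takes the value \<open>t\<close> beyond \<open>r\<close>; as \<open>r\<close> is the last
          point where \<open>G\<close> is at most \<open>t\<close>, it does so at \<open>r\<close> itself.\<close>
        have "\<exists>x\<ge>r. x \<le> b \<and> ?G x = t"
          using rS b Sb[OF rS] continuous_on_subset[OF contG] by (intro IVT') auto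
        then obtain x where x: "r \<le> x" "?G x = t" by auto
        then have "x \<in> ?S" by simp
        then have "x = r" using x(1) S_eq by auto
        then have "measure M {..r} = t" using x by (simp add: cdf_def)
        then show ?thesis by (simp add: L R' S_eq)
      qed
    qed
  qed
qed

lemma integral_cos_uniform:
  "(\<integral>t. cos (of_int k * pi * t) \<partial>uniform_measure lborel {0..1}) = (if k = 0 then 1 else 0)"
proof -
  have dens: "uniform_measure lborel {0..1::real} = density lborel (\<lambda>x. ennreal (indicator {0..1} x))"
    by (simp add: uniform_measure_def ennreal_indicator divide_ennreal_def)
  have "(\<integral>t. cos (of_int k * pi * t) \<partial>uniform_measure lborel {0..1})
      = (\<integral>t. indicator {0..1} t *\<^sub>R cos (of_int k * pi * t) \<partial>lborel)"
    unfolding dens by (subst integral_density) auto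
  also have "\<dots> = (if k = 0 then 1 else 0)"
  proof (cases "k = 0")
    case True
    then show ?thesis by simp
  next
    case False
    let ?P = "\<lambda>t. sin (of_int k * pi * t) / (of_int k * pi)"
    have "(\<integral>t. cos (of_int k * pi * t) * indicator {0..1} t \<partial>lborel) = ?P 1 - ?P 0"
      using False by (intro integral_FTC_Icc_real) (auto intro!: derivative_eq_intros continuous_intros)
    also have "\<dots> = 0" using sin_npi_int[of k] by (simp add: mult.commute)
    finally show ?thesis using False by (simp add: mult.commute)
  qed
  finally show ?thesis .
qed

section \<open>Binary sequences as real numbers\<close>

text \<open>A continuous injection of a compact space maps complements of open sets to closed sets, so every
open set, and then every Borel set, is the preimage of a Borel set. This turns statements about
Borel sets of sequences into statements about Borel sets of reals.\<close>

lemma vimage_borel_of_compact_inj: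
  fixes f :: "'a::topological_space \<Rightarrow> 'b::t2_space"
  assumes comp: "compact (UNIV :: 'a set)" and cont: "continuous_on UNIV f" and inj: "inj f"
    and B: "B \<in> sets borel"
  shows "\<exists>C\<in>sets borel. B = f -` C"
proof -
  let ?V = "vimage_algebra UNIV f borel"
  have V: "sets ?V = {f -` C | C. C \<in> sets borel}"
    by (subst sets_vimage_algebra2) auto
  have "S \<in> sets ?V" if "open S" for S
  proof -
    have "compact (- S)" using comp that by (metis Compl_eq_Diff_UNIV compact_diff)
    then have "compact (f ` (- S))"
      using cont by (intro compact_continuous_image) (auto intro: continuous_on_subset)
    then have "closed (f ` (- S))" by (rule compact_imp_closed)
    then have "- (f ` (- S)) \<in> sets borel" by (intro borel_open) auto
    moreover have "S = f -` (- (f ` (- S)))" using inj by (auto simp: inj_def)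
    ultimately show ?thesis unfolding V by blast
  qed
  then have "sigma_sets (space ?V) {S. open S} \<subseteq> sets ?V"
    by (intro sets.sigma_sets_subset) auto
  moreover have "B \<in> sigma_sets UNIV {S. open S}" using B by (simp add: borel_def)
  ultimately have "B \<in> sets ?V" by auto
  then show ?thesis unfolding V by blast
qed

lemma compact_bseq: "compact (UNIV :: bseq set)"
proof -
  have "compact_space (product_topology (\<lambda>_::nat. euclidean :: bool topology) UNIV)"
    by (subst compact_space_product_topology) (auto simp: compact_space_def intro: finite_imp_compact)
  then show ?thesis by (simp add: euclidean_product_topology compact_space_def)
qed

text \<open>Digits 0 and 1 in base 3: the Cantor embedding up to scaling. Base 3 rather than 2 makes it
injective, since the tail after the first digit contributes at most 1/2.\<close>

definition ternary_value :: "bseq \<Rightarrow> real" where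
  "ternary_value x = (\<Sum>n. of_bool (x n) * (1 / 3) ^ n)"

lemma summable_ternary: "summable (\<lambda>n. of_bool (x n) * (1 / 3 :: real) ^ n)"
  by (rule summable_comparison_test[of _ "\<lambda>n. (1 / 3 :: real) ^ n"]) auto

lemma ternary_value_bounds: "0 \<le> ternary_value x" "ternary_value x \<le> 3 / 2"
proof -
  show "0 \<le> ternary_value x"
    unfolding ternary_value_def by (intro suminf_nonneg summable_ternary) auto
  have "ternary_value x \<le> (\<Sum>n. (1 / 3 :: real) ^ n)"
    unfolding ternary_value_def by (intro suminf_le summable_ternary) auto
  also have "\<dots> = 3 / 2" by (subst suminf_geometric) auto
  finally show "ternary_value x \<le> 3 / 2" .
qed

lemma ternary_value_shift: "ternary_value x = of_bool (x 0) + ternary_value (shift x) / 3"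
proof -
  have "ternary_value x = of_bool (x 0) + (\<Sum>n. of_bool (x (Suc n)) * (1 / 3) ^ Suc n)"
    unfolding ternary_value_def by (subst suminf_split_head[OF summable_ternary]) simp
  also have "(\<Sum>n. of_bool (x (Suc n)) * (1 / 3 :: real) ^ Suc n)
      = (\<Sum>n. (of_bool (shift x n) * (1 / 3) ^ n) / 3)"
    by (simp add: shift_def)
  also have "\<dots> = ternary_value (shift x) / 3"
    unfolding ternary_value_def by (rule suminf_divide[OF summable_ternary])
  finally show ?thesis .
qed

lemma inj_ternary_value: "inj ternary_value"
proof (rule injI)
  have step: "x 0 = y 0 \<and> ternary_value (shift x) = ternary_value (shift y)"
    if "ternary_value x = ternary_value y" for x y
    using that ternary_value_shift[of x] ternary_value_shift[of y]
      ternary_value_bounds[of "shift x"] ternary_value_bounds[of "shift y"]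
    by (cases "x 0"; cases "y 0") auto
  have "x n = y n" if "ternary_value x = ternary_value y" for x y n
    using that
  proof (induction n arbitrary: x y)
    case 0 then show ?case using step by blast
  next
    case (Suc n)
    then have "shift x n = shift y n" using step by blast
    then show ?case by (simp add: shift_def)
  qed
  then show "x = y" if "ternary_value x = ternary_value y" for x y using that by blast
qed

lemma continuous_on_coordinate:
  fixes g :: "bool \<Rightarrow> real"
  shows "continuous_on UNIV (\<lambda>x::bseq. g (x n))"
proof -
  have "continuous_on UNIV g" by (simp add: continuous_on_open_vimage open_discrete)
  then show ?thesis
    by (rule continuous_on_compose2[OF _ continuous_on_product_coordinates]) auto
qed

lemma continuous_ternary_value: "continuous_on UNIV ternary_value"
proof (rule uniform_limit_theorem[where F = sequentially])
  show "uniform_limit UNIV (\<lambda>n x. \<Sum>i<n. of_bool (x i) * (1 / 3 :: real) ^ i) ternary_value sequentially"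
    unfolding ternary_value_def[abs_def]
    by (rule Weierstrass_m_test[where M = "\<lambda>n. (1 / 3) ^ n"]) auto
  show "\<forall>\<^sub>F n in sequentially. continuous_on UNIV (\<lambda>x. \<Sum>i<n. of_bool (x i) * (1 / 3 :: real) ^ i)"
    by (intro always_eventually allI continuous_intros continuous_on_coordinate)
qed simp

section \<open>The equilibrium probability has no atoms\<close>

definition prepend :: "bool \<Rightarrow> bseq \<Rightarrow> bseq" where
  "prepend b x = case_nat b x"

lemma shift_vimage: "shift -` {x} = {prepend False x, prepend True x}"
proof -
  have "y \<in> {prepend False x, prepend True x}" if "shift y = x" for y
  proof -
    have "y = prepend (y 0) x"
      using that by (auto simp: prepend_def shift_def fun_eq_iff split: nat.split)
    then show ?thesis by (cases "y 0") auto
  qed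
  moreover have "shift (prepend b x) = x" for b by (simp add: shift_def prepend_def)
  ultimately show ?thesis by auto
qed

lemma sum_shift_vimage: "(\<Sum>y\<in>shift -` {x}. f y) = f (prepend False x) + (f (prepend True x) :: real)"
proof -
  have "prepend False x \<noteq> prepend True x" by (metis prepend_def old.nat.simps(4))
  then show ?thesis by (simp add: shift_vimage)
qed

lemma holder_bounded_below:
  assumes "holder A"
  shows "\<exists>B. \<forall>x. B \<le> A x"
proof -
  obtain C \<alpha> where C: "0 < \<alpha>" "\<And>x y. \<bar>A x - A y\<bar> \<le> C * bseq_dist x y powr \<alpha>"
    using assms unfolding holder_def by blast
  define z :: bseq where "z = (\<lambda>_. False)"
  have "A z - \<bar>C\<bar> \<le> A x" for x
  proof -
    have "0 \<le> bseq_dist x z" "bseq_dist x z \<le> 1" by (auto simp: bseq_dist_def power_le_one)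
    then have "bseq_dist x z powr \<alpha> \<le> 1" using C(1) by (simp add: powr_le1)
    then have "\<bar>C\<bar> * bseq_dist x z powr \<alpha> \<le> \<bar>C\<bar> * 1" by (intro mult_left_mono) auto
    moreover have "C * bseq_dist x z powr \<alpha> \<le> \<bar>C\<bar> * bseq_dist x z powr \<alpha>"
      by (intro mult_right_mono) auto
    ultimately show ?thesis using C(2)[of x z] by linarith
  qed
  then show ?thesis by blast
qed

text \<open>The two values over a fibre sum to 1, and both are at least a positive constant because \<open>A\<close> is bounded
below.\<close>

lemma jacobian_less_one:
  assumes "holder A" "normalized A"
  shows "\<exists>\<theta>. 0 \<le> \<theta> \<and> \<theta> < 1 \<and> (\<forall>b x. exp (A (prepend b x)) \<le> \<theta>)"
proof -
  obtain B where B: "\<And>x. B \<le> A x" using holder_bounded_below[OF assms(1)] by blast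
  have sum1: "exp (A (prepend False x)) + exp (A (prepend True x)) = 1" for x
    using assms(2) unfolding normalized_def by (simp add: sum_shift_vimage)
  have "exp (A (prepend b x)) \<le> 1 - exp B" for b x
  proof -
    have "exp B \<le> exp (A (prepend (\<not> b) x))" using B by simp
    then show ?thesis using sum1[of x] by (cases b) (simp_all add: algebra_simps del: exp_le_cancel_iff)
  qed
  moreover from this have "0 \<le> 1 - exp B" using exp_ge_zero order_trans by blast
  ultimately show ?thesis by (intro exI[of _ "1 - exp B"]) auto
qed

definition cylinder :: "nat \<Rightarrow> bseq \<Rightarrow> bseq set" where
  "cylinder n x = {y. \<forall>i<n. y i = x i}"

lemma indicator_cylinder: "indicator (cylinder n x) y = (\<Prod>i<n. of_bool (y i = x i) :: real)"
proof (cases "y \<in> cylinder n x")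
  case True
  then show ?thesis by (simp add: cylinder_def)
next
  case False
  then show ?thesis by (auto simp: cylinder_def)
qed

lemma continuous_indicator_cylinder:
  "continuous_on UNIV (\<lambda>y. indicator (cylinder n x) y :: real)"
  unfolding indicator_cylinder
  by (intro continuous_on_prod continuous_on_coordinate)

lemma indicator_cylinder_prepend:
  "indicator (cylinder (Suc n) x) (prepend b y) =
    (of_bool (b = x 0) * indicator (cylinder n (shift x)) y :: real)"
  unfolding indicator_cylinder prod.lessThan_Suc_shift
  by (simp add: prepend_def shift_def)

lemma cylinder_in_borel: "cylinder n x \<in> sets borel"
proof -
  have "(\<lambda>y. indicator (cylinder n x) y :: real) \<in> borel_measurable borel"
    by (rule borel_measurable_continuous_onI[OF continuous_indicator_cylinder])
  then show ?thesis by (simp add: borel_measurable_indicator_iff)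
qed

text \<open>The transfer operator maps the indicator of the cylinder of length $n+1$ around \<open>x\<close> to a function
bounded by $\theta$ times the indicator of the cylinder of length \<open>n\<close> around the shift of \<open>x\<close>: over
each point only the preimage with first digit \<open>x 0\<close> contributes.\<close>

lemma equilibrium_cylinder_le:
  assumes eq: "equilibrium_probability A \<mu>"
    and \<theta>: "0 \<le> \<theta>" "\<And>b x. exp (A (prepend b x)) \<le> \<theta>"
  shows "measure \<mu> (cylinder n x) \<le> \<theta> ^ n"
proof (induction n arbitrary: x)
  case 0
  interpret prob_space \<mu> using eq by (simp add: equilibrium_probability_def)
  show ?case by simp
next
  case (Suc n)
  interpret prob_space \<mu> using eq by (simp add: equilibrium_probability_def)
  have sb: "sets \<mu> = sets borel" using eq by (simp add: equilibrium_probability_def)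
  have [measurable]: "cylinder k y \<in> sets \<mu>" for k y using cylinder_in_borel sb by simp
  let ?f = "\<lambda>y. indicator (cylinder (Suc n) x) y :: real"
  have le: "transfer_op A ?f z \<le> \<theta> * indicator (cylinder n (shift x)) z" for z
    using \<theta>(2)[of False z] \<theta>(2)[of True z]
    by (cases "x 0") (auto simp: transfer_op_def sum_shift_vimage indicator_cylinder_prepend
        intro!: mult_right_mono)
  have "measure \<mu> (cylinder (Suc n) x) = (\<integral>y. ?f y \<partial>\<mu>)" by simp
  also have "\<dots> = (\<integral>y. transfer_op A ?f y \<partial>\<mu>)"
    using eq continuous_indicator_cylinder unfolding equilibrium_probability_def by metis
  also have "\<dots> \<le> (\<integral>y. \<theta> * indicator (cylinder n (shift x)) y \<partial>\<mu>)"
  proof (rule integral_mono')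
    show "integrable \<mu> (\<lambda>y. \<theta> * indicator (cylinder n (shift x)) y)"
      by (intro integrable_mult_right integrable_real_indicator) (auto simp: less_top[symmetric])
  qed (use le \<theta>(1) in auto)
  also have "\<dots> = \<theta> * measure \<mu> (cylinder n (shift x))" by simp
  also have "\<dots> \<le> \<theta> * \<theta> ^ n" using Suc.IH \<theta>(1) by (intro mult_left_mono)
  finally show ?case by simp
qed

lemma equilibrium_atomless:
  assumes "holder A" "normalized A" and eq: "equilibrium_probability A \<mu>"
  shows "measure \<mu> {x} = 0"
proof -
  interpret prob_space \<mu> using eq by (simp add: equilibrium_probability_def)
  have sb: "sets \<mu> = sets borel" using eq by (simp add: equilibrium_probability_def)
  obtain \<theta> where \<theta>: "0 \<le> \<theta>" "\<theta> < 1" "\<And>b x. exp (A (prepend b x)) \<le> \<theta>"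
    using jacobian_less_one[OF assms(1,2)] by blast
  have "measure \<mu> {x} \<le> \<theta> ^ n" for n
  proof -
    have "measure \<mu> {x} \<le> measure \<mu> (cylinder n x)"
      using cylinder_in_borel sb by (intro finite_measure_mono) (auto simp: cylinder_def)
    also have "\<dots> \<le> \<theta> ^ n" by (rule equilibrium_cylinder_le[OF eq \<theta>(1,3)])
    finally show ?thesis .
  qed
  moreover have "(\<lambda>n. \<theta> ^ n) \<longlonglongrightarrow> 0" using \<theta> by (intro LIMSEQ_realpow_zero)
  ultimately have "measure \<mu> {x} \<le> 0" by (intro LIMSEQ_le_const) auto
  then show ?thesis using measure_nonneg[of \<mu> "{x}"] by linarith
qed


section \<open>The cosine basis of a uniformly distributed function\<close>

definition cosine_system :: "('a \<Rightarrow> real) \<Rightarrow> nat \<Rightarrow> 'a \<Rightarrow> real" where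
  "cosine_system F n x = (if n = 0 then 1 else sqrt 2 * cos (real n * (pi * F x)))"

lemma abs_cosine_system_le: "\<bar>cosine_system F n x\<bar> \<le> sqrt 2"
  by (simp add: cosine_system_def abs_mult mult_left_le)

lemma (in prob_space) cosine_system_in_L2_space:
  assumes [measurable]: "F \<in> borel_measurable M"
  shows "cosine_system F n \<in> L2_space M"
proof (rule bounded_in_L2_space[OF _ abs_cosine_system_le])
  show "cosine_system F n \<in> borel_measurable M"
    unfolding cosine_system_def[abs_def] by measurable
qed

text \<open>Product-to-sum reduces the claim to the integrals of $\cos (k \pi t)$. Integer frequencies keep the
difference $m - n$ free of case distinctions.\<close>

lemma (in prob_space) cosine_system_orthonormal:
  assumes F[measurable]: "F \<in> borel_measurable M"
    and unif: "distr M borel F = uniform_measure lborel {0..1}"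
  shows "L2_inner M (cosine_system F m) (cosine_system F n) = (if m = n then 1 else 0)"
proof -
  define C where "C k x = cos (of_int k * pi * F x)" for k :: int and x
  have Ci: "integrable M (C k)" for k
    unfolding C_def by (intro integrable_const_bound[where B = 1]) auto
  have CI: "(\<integral>x. C k x \<partial>M) = (if k = 0 then 1 else 0)" for k
  proof -
    have "(\<integral>x. C k x \<partial>M) = (\<integral>t. cos (of_int k * pi * t) \<partial>distr M borel F)"
      unfolding C_def by (subst integral_distr) auto
    then show ?thesis unfolding unif integral_cos_uniform .
  qed
  define w :: "nat \<Rightarrow> real" where "w n = (if n = 0 then 1 else sqrt 2)" for n
  have "cosine_system F m x * cosine_system F n x
      = w m * w n / 2 * (C (int m - int n) x + C (int m + int n) x)" for x
  proof -
    have "cosine_system F m x * cosine_system F n x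
        = w m * w n * (cos (real m * (pi * F x)) * cos (real n * (pi * F x)))"
      by (simp add: cosine_system_def w_def)
    also have "cos (real m * (pi * F x)) * cos (real n * (pi * F x))
        = (C (int m - int n) x + C (int m + int n) x) / 2"
      unfolding C_def cos_times_cos by (simp add: algebra_simps)
    finally show ?thesis by simp
  qed
  then have "L2_inner M (cosine_system F m) (cosine_system F n)
      = (\<integral>x. w m * w n / 2 * (C (int m - int n) x + C (int m + int n) x) \<partial>M)"
    unfolding L2_inner_def by (simp only:)
  also have "\<dots> = w m * w n / 2 * ((\<integral>x. C (int m - int n) x \<partial>M) + (\<integral>x. C (int m + int n) x \<partial>M))"
    by (subst integral_mult_right_zero, subst Bochner_Integration.integral_add) (simp_all add: Ci)
  also have "\<dots> = (if m = n then 1 else 0)"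
    unfolding CI by (auto simp: w_def)
  finally show ?thesis .
qed

text \<open>The induction on \<open>k\<close> needs the products $\cos^k \theta \cos n\theta$ for all \<open>n\<close>: one factor
$\cos \theta$ turns frequency \<open>n\<close> into the average of frequencies $n+1$ and $n-1$.\<close>

lemma (in prob_space) cos_power_in_cosine_span:
  assumes F: "F \<in> borel_measurable M"
  shows "(\<lambda>x. cos (pi * F x) ^ k) \<in> L2_closed_span M (cosine_system F)"
proof -
  note L2 = cosine_system_in_L2_space[OF F]
  have "(\<lambda>x. cos (pi * F x) ^ k * cos (real n * (pi * F x))) \<in> L2_closed_span M (cosine_system F)" for n
  proof (induction k arbitrary: n)
    case 0
    have "(\<lambda>x. (if n = 0 then 1 else 1 / sqrt 2) * cosine_system F n x) \<in> L2_closed_span M (cosine_system F)"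
      by (intro L2_closed_span_scale L2_closed_span_base L2)
    moreover have "(if n = 0 then 1 else 1 / sqrt 2) * cosine_system F n x
        = cos (pi * F x) ^ 0 * cos (real n * (pi * F x))" for x
      by (simp add: cosine_system_def)
    ultimately show ?case by (simp only:)
  next
    case (Suc k)
    \<comment> \<open>For \<open>n = 0\<close> the frequency \<open>n - 1\<close> is replaced by its absolute value 1.\<close>
    have prod: "cos t * cos (real n * t)
        = (1 / 2) * cos (real (Suc n) * t) + (1 / 2) * cos (real (if n = 0 then 1 else n - 1) * t)" for t
    proof (cases n)
      case (Suc j)
      have "cos (real (Suc j) * t) * cos t = (cos (real j * t) + cos (real (Suc (Suc j)) * t)) / 2"
        unfolding cos_times_cos by (simp add: algebra_simps)
      then show ?thesis using Suc by (simp add: field_simps)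
    qed simp
    have "(\<lambda>x. (1 / 2) * (cos (pi * F x) ^ k * cos (real (Suc n) * (pi * F x)))
          + (1 / 2) * (cos (pi * F x) ^ k * cos (real (if n = 0 then 1 else n - 1) * (pi * F x))))
        \<in> L2_closed_span M (cosine_system F)"
      by (intro L2_closed_span_add[OF L2] L2_closed_span_scale Suc)
    moreover have "cos (pi * F x) ^ Suc k * cos (real n * (pi * F x))
        = (1 / 2) * (cos (pi * F x) ^ k * cos (real (Suc n) * (pi * F x)))
          + (1 / 2) * (cos (pi * F x) ^ k * cos (real (if n = 0 then 1 else n - 1) * (pi * F x)))" for x
    proof -
      have "cos (pi * F x) ^ Suc k * cos (real n * (pi * F x))
          = cos (pi * F x) ^ k * (cos (pi * F x) * cos (real n * (pi * F x)))"
        by simp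
      then show ?thesis unfolding prod by (simp only: distrib_left mult.left_commute)
    qed
    ultimately show ?case by simp
  qed
  from this[of 0] show ?thesis by simp
qed

text \<open>The distribution function loses the difference between \<open>\<phi> \<le> r\<close> and \<open>F \<le> G r\<close> only where
\<open>F = G r\<close>, and this level set is null because \<open>F\<close> is uniformly distributed. So the half-lines of \<open>\<phi>\<close>
are, up to null sets, superlevel sets of $\cos (\pi F)$, and by assumption on \<open>\<phi>\<close> they generate all
measurable sets.\<close>

lemma (in prob_space) cosine_system_hilbert_basis:
  fixes \<phi> :: "'a \<Rightarrow> real"
  assumes \<phi>[measurable]: "\<phi> \<in> borel_measurable M"
    and gen: "\<And>B. B \<in> sets M \<Longrightarrow> \<exists>C\<in>sets borel. B = \<phi> -` C \<inter> space M"
    and atomless: "\<And>r. measure M {x \<in> space M. \<phi> x = r} = 0"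
  shows "L2_hilbert_basis M (cosine_system (\<lambda>x. cdf (distr M borel \<phi>) (\<phi> x)))"
proof -
  let ?N = "distr M borel \<phi>"
  let ?F = "\<lambda>x. cdf ?N (\<phi> x)"
  let ?S = "L2_closed_span M (cosine_system ?F)"
  interpret N: real_distribution ?N by (rule real_distribution_distr) simp
  have Natom: "measure ?N {r} = 0" for r
  proof -
    have "\<phi> -` {r} \<inter> space M = {x \<in> space M. \<phi> x = r}" by auto
    then show ?thesis using atomless by (subst measure_distr) auto
  qed
  have G[measurable]: "cdf ?N \<in> borel_measurable borel"
    using Natom
    by (intro borel_measurable_continuous_onI continuous_at_imp_continuous_on) (auto simp: N.isCont_cdf)
  have F[measurable]: "?F \<in> borel_measurable M" by measurable
  have unif: "distr M borel ?F = uniform_measure lborel {0..1}"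
    using N.distr_cdf_uniform[OF Natom] by (subst (asm) distr_distr) (auto simp: comp_def)
  note L2 = cosine_system_in_L2_space[OF F]
  have F01: "0 \<le> ?F x" "?F x \<le> 1" for x by (rule N.cdf_nonneg, rule N.cdf_bounded_prob)
  have F_neq: "AE x in M. ?F x \<noteq> s" for s
  proof -
    have "emeasure (distr M borel ?F) {s} = 0"
      unfolding unif by (subst emeasure_uniform_measure) (auto simp: Int_insert_right)
    then have "AE t in distr M borel ?F. t \<noteq> s"
      by (intro AE_I[where N = "{s}"]) auto
    then show ?thesis by (subst (asm) AE_distr_iff) auto
  qed
  have le: "(\<lambda>x. indicator {..r} (\<phi> x)) \<in> ?S" for r
  proof (rule L2_closed_span_AE_eq[OF L2])
    let ?c = "cos (pi * cdf ?N r)"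
    show "(\<lambda>x. indicator {?c..} (cos (pi * ?F x))) \<in> ?S"
      by (rule superlevel_in_L2_closed_span[OF L2 _ _ cos_power_in_cosine_span[OF F]]) auto
    show "AE x in M. indicator {?c..} (cos (pi * ?F x)) = (indicator {..r} (\<phi> x) :: real)"
      using F_neq[of "cdf ?N r"]
    proof eventually_elim
      case (elim x)
      have "?c \<le> cos (pi * ?F x) \<longleftrightarrow> pi * ?F x \<le> pi * cdf ?N r"
        using F01(1)[of x] F01(2)[of x] N.cdf_nonneg[of r] N.cdf_bounded_prob[of r]
        by (intro cos_mono_le_eq) (auto simp: mult_left_le)
      also have "\<dots> \<longleftrightarrow> ?F x \<le> cdf ?N r" by simp
      also have "\<dots> \<longleftrightarrow> \<phi> x \<le> r"
        using N.cdf_nondecreasing[of "\<phi> x" r] N.cdf_nondecreasing[of r "\<phi> x"] elim by linarith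
      finally show ?case by (simp add: indicator_def)
    qed
  qed measurable
  have one: "(\<lambda>x. 1) \<in> ?S"
    using cos_power_in_cosine_span[OF F, of 0] by simp
  have ind: "(\<lambda>x. indicator B x) \<in> ?S" if B: "B \<in> sets M" for B
  proof -
    obtain C where C: "C \<in> sets borel" "B = \<phi> -` C \<inter> space M" using gen[OF B] by blast
    show ?thesis
    proof (rule L2_closed_span_AE_eq[OF L2])
      show "(\<lambda>x. indicator C (\<phi> x)) \<in> ?S"
        by (rule borel_vimage_in_L2_closed_span[OF L2 \<phi> one le C(1)])
      show "AE x in M. indicator C (\<phi> x) = (indicator B x :: real)"
        by (intro AE_I2) (simp add: C(2) indicator_def)
    qed (use B in measurable)
  qed
  have "f \<in> ?S" if "f \<in> L2_space M" for f
    by (rule L2_closed_span_eq_L2_space[OF L2 ind that])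
  then show ?thesis
    unfolding L2_hilbert_basis_def
    using L2 cosine_system_orthonormal[OF F unif] by (auto simp: L2_closed_span_def)
qed

section \<open>Fourier-like bases\<close>

text \<open>Upper bounds come from $|\rho_n| \le \sqrt 2$. The lower bound on the supremum norm holds because on
a probability space it dominates the $L^2$ norm, which is 1.\<close>

lemma fourier_like_basis_of_atomless:
  fixes \<mu> :: "bseq measure"
  assumes "prob_space \<mu>" and sb: "sets \<mu> = sets borel" and atomless: "\<And>x. measure \<mu> {x} = 0"
  shows "\<exists>\<rho>. fourier_like_basis \<mu> \<rho>"
proof -
  interpret prob_space \<mu> by fact
  let ?\<phi> = ternary_value
  have [measurable]: "?\<phi> \<in> borel_measurable \<mu>"
    using borel_measurable_continuous_onI[OF continuous_ternary_value]
    by (simp add: measurable_cong_sets[OF sb refl])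
  have sp: "space \<mu> = UNIV" using sets_eq_imp_space_eq[OF sb] by simp
  have atom: "measure \<mu> {x \<in> space \<mu>. ?\<phi> x = r} = 0" for r
  proof (cases "\<exists>y. ?\<phi> y = r")
    case True
    then obtain y where "?\<phi> y = r" by blast
    then have "{x \<in> space \<mu>. ?\<phi> x = r} = {y}" using inj_ternary_value by (auto simp: sp inj_def)
    then show ?thesis using atomless by simp
  qed simp
  let ?N = "distr \<mu> borel ?\<phi>"
  let ?F = "\<lambda>x. cdf ?N (?\<phi> x)"
  let ?\<rho> = "cosine_system ?F"
  interpret N: real_distribution ?N by (rule real_distribution_distr) simp
  have hb: "L2_hilbert_basis \<mu> ?\<rho>"
    using vimage_borel_of_compact_inj[OF compact_bseq continuous_ternary_value inj_ternary_value] atom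
    by (intro cosine_system_hilbert_basis) (auto simp: sb sp)
  have "measure ?N {r} = 0" for r
  proof -
    have "?\<phi> -` {r} \<inter> space \<mu> = {x \<in> space \<mu>. ?\<phi> x = r}" by auto
    then show ?thesis using atom by (subst measure_distr) auto
  qed
  then have "continuous_on UNIV (cdf ?N)"
    by (intro continuous_at_imp_continuous_on) (auto simp: N.isCont_cdf)
  then have contF: "continuous_on UNIV ?F"
    using continuous_ternary_value by (rule continuous_on_compose2) auto
  have cont: "continuous_on UNIV (?\<rho> n)" for n
  proof -
    have "continuous_on UNIV (\<lambda>x. sqrt 2 * cos (real n * (pi * ?F x)))"
      by (rule continuous_on_compose2[OF _ contF, of UNIV "\<lambda>t. sqrt 2 * cos (real n * (pi * t))"])
         (auto intro!: continuous_intros)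
    then show ?thesis unfolding cosine_system_def[abs_def] by (cases "n = 0") simp_all
  qed
  have norm1: "L2_norm \<mu> (?\<rho> n) = 1" for n
    using hb by (simp add: L2_norm_def L2_hilbert_basis_def)
  have bdd: "bdd_above (range (\<lambda>x. \<bar>?\<rho> n x\<bar>))" for n
    by (rule bdd_aboveI[where M = "sqrt 2"]) (auto simp: abs_cosine_system_le)
  have C0_le: "C0_norm (?\<rho> n) \<le> sqrt 2" for n
    unfolding C0_norm_def by (rule cSUP_least) (auto simp: abs_cosine_system_le)
  have C0_ge: "1 \<le> C0_norm (?\<rho> n)" for n
  proof -
    have le: "\<bar>?\<rho> n x\<bar> \<le> C0_norm (?\<rho> n)" for x
      unfolding C0_norm_def using bdd by (rule cSUP_upper[OF UNIV_I])
    then have nn: "0 \<le> C0_norm (?\<rho> n)" using abs_ge_zero order_trans by blast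
    have "L2_inner \<mu> (?\<rho> n) (?\<rho> n) \<le> (\<integral>x. (C0_norm (?\<rho> n))\<^sup>2 \<partial>\<mu>)"
      unfolding L2_inner_def
    proof (rule integral_mono')
      show "?\<rho> n x * ?\<rho> n x \<le> (C0_norm (?\<rho> n))\<^sup>2" for x
        using power_mono[OF le[of x], of 2] by (simp add: power2_eq_square)
    qed auto
    then have "1\<^sup>2 \<le> (C0_norm (?\<rho> n))\<^sup>2"
      using hb prob_space by (simp add: L2_hilbert_basis_def)
    then show ?thesis using nn by (rule power2_le_imp_le)
  qed
  have "0 < (1::real) \<and> 0 < sqrt (2::real) \<and> (\<forall>n. 1 \<le> C0_norm (?\<rho> n) \<and> C0_norm (?\<rho> n) \<le> sqrt 2 \<and>
      1 \<le> L2_norm \<mu> (?\<rho> n) \<and> L2_norm \<mu> (?\<rho> n) \<le> sqrt 2)"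
    using C0_ge C0_le by (simp add: norm1)
  then have "fourier_like_basis \<mu> ?\<rho>"
    unfolding fourier_like_basis_def using hb cont by blast
  then show ?thesis by blast
qed

theorem mainTheorem4:
  fixes A :: "bseq \<Rightarrow> real" and \<mu> :: "bseq measure"
  assumes "holder A" and "normalized A" and "equilibrium_probability A \<mu>"
  shows "\<exists>\<rho>. fourier_like_basis \<mu> \<rho>"
proof (rule fourier_like_basis_of_atomless)
  show "prob_space \<mu>" "sets \<mu> = sets borel"
    using assms(3) by (simp_all add: equilibrium_probability_def)
  show "measure \<mu> {x} = 0" for x by (rule equilibrium_atomless[OF assms])
qed

end
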